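(* Let $q$ be a complex number with $0<|q|<1$ and let $a,b,c,d$ be nonzero complex numbers such that no denominator occurring below vanishes. Then $$\frac{(b;q)_\infty(c;q)_\infty(qd;q)_\infty(qa^2/bcd;q)_\infty}{(qa/b;q)_\infty(qa/c;q)_\infty(a/d;q)_\infty(bcd/a;q)_\infty} =\sum_{n=0}^{\infty}W_n(a,b,c,d)\left(\frac{q^{n}a^2}{bd}\right)^n\frac{(bd/a;q)_{2n}\,(b,\,qd,\,q^2a/bc,\,bc/a,\,qa/cd,\,cd/a;q)_n}{(q,\,qa/c,\,bcd/a;q)_{2n}\,(qa/b,\,qa/d;q)_n},$$ where $$W_n(a,b,c,d)=\frac{(1-qa/bc)(1-q^ncd/a)(1-q^{2n}bd/a)(1-q^{1+3n}b)}{(1-a/d)(1-q^{1+2n})(1-q^{1+2n}a/c)(1-q^{2n}bcd/a)}$$ $$\times\left\{q^n\frac ad+\frac{(1-q^na/d)(1-q^{1+2n})(1-q^{1+2n}a/c)(1-q^{2n}bcd/a)(1-q^{3n}d)}{(1-q^{1+n}a/bc)(1-q^nd)(1-q^ncd/a)(1-q^{2n}bd/a)(1-q^{1+3n}b)}\right\}.$$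
   Context: $(x;q)_0=1$, $(x;q)_n=\prod_{j=0}^{n-1}(1-q^jx)$ for $n\ge1$, $(x;q)_\infty=\prod_{j\ge0}(1-q^jx)$, and $(x_1,\dots,x_r;q)_n=(x_1;q)_n\cdots(x_r;q)_n$. Expressions such as $a/bc$ mean $a/(bc)$. *)

theory Defs
  imports "HOL-Analysis.Analysis"
begin

definition qpoch :: "complex \<Rightarrow> complex \<Rightarrow> nat \<Rightarrow> complex" where
  "qpoch x q n = (\<Prod>j<n. 1 - q ^ j * x)"

(* prodinf has the value 0 (rather than being undefined) when finitely many factors vanish,
   so for norm q < 1 this is the limit of the partial products without exception. *)
definition qpoch_inf :: "complex \<Rightarrow> complex \<Rightarrow> complex" where
  "qpoch_inf x q = (\<Prod>j. 1 - q ^ j * x)"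

(* (x_1, ..., x_r; q)_n *)
definition qpochs :: "complex list \<Rightarrow> complex \<Rightarrow> nat \<Rightarrow> complex" where
  "qpochs xs q n = (\<Prod>x\<leftarrow>xs. qpoch x q n)"

definition W_prefactor_den ::
    "complex \<Rightarrow> nat \<Rightarrow> complex \<Rightarrow> complex \<Rightarrow> complex \<Rightarrow> complex \<Rightarrow> complex" where
  "W_prefactor_den q n a b c d =
     (1 - a / d) * (1 - q ^ (1 + 2 * n)) * (1 - q ^ (1 + 2 * n) * a / c)
       * (1 - q ^ (2 * n) * b * c * d / a)"

definition W_brace_den ::
    "complex \<Rightarrow> nat \<Rightarrow> complex \<Rightarrow> complex \<Rightarrow> complex \<Rightarrow> complex \<Rightarrow> complex" where
  "W_brace_den q n a b c d =
     (1 - q ^ (1 + n) * a / (b * c)) * (1 - q ^ n * d) * (1 - q ^ n * c * d / a)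
       * (1 - q ^ (2 * n) * b * d / a) * (1 - q ^ (1 + 3 * n) * b)"

definition W ::
    "complex \<Rightarrow> nat \<Rightarrow> complex \<Rightarrow> complex \<Rightarrow> complex \<Rightarrow> complex \<Rightarrow> complex" where
  "W q n a b c d =
     ((1 - q * a / (b * c)) * (1 - q ^ n * c * d / a) * (1 - q ^ (2 * n) * b * d / a)
        * (1 - q ^ (1 + 3 * n) * b))
     / W_prefactor_den q n a b c d
     * (q ^ n * (a / d)
        + ((1 - q ^ n * a / d) * (1 - q ^ (1 + 2 * n)) * (1 - q ^ (1 + 2 * n) * a / c)
             * (1 - q ^ (2 * n) * b * c * d / a) * (1 - q ^ (3 * n) * d))
          / W_brace_den q n a b c d)"

end

theory Submission
  imports Defs
begin

text \<open>
  Splitting the braces of \<open>W\<close> writes the \<open>n\<close>-th summand as \<open>E\<^sub>n + O\<^sub>n\<close> with hypergeometric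
  terms \<open>E\<^sub>n, O\<^sub>n\<close>. The shift \<open>(a, b, c, d) \<mapsto> (q\<^sup>2a, qb, qc, qd)\<close> divides the infinite product by a
  rational factor \<open>\<rho>\<close>, and the series obeys the same rule: with suitable certificates \<open>G\<^sub>n, H\<^sub>n\<close>,
  writing \<open>'\<close> for shifted parameters, \<open>\<rho>E'\<^sub>n - E\<^sub>n = H\<^sub>n - G\<^sub>n\<close> and
  \<open>\<rho>O'\<^sub>n - O\<^sub>n = G\<^sub>n\<^sub>+\<^sub>1 - H\<^sub>n\<close>, where \<open>G\<^sub>0 = 0\<close> and \<open>G\<^sub>n \<rightarrow> 0\<close>. Iterating the shift sends \<open>a, b, c, d\<close>
  to \<open>0\<close> while \<open>bd/a\<close>, \<open>a/bc\<close>, \<open>bc/a\<close>, \<open>a/cd\<close>, \<open>cd/a\<close> stay fixed, so by Tannery's theorem the shifted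
  series tends to its zeroth term \<open>1\<close>, while the accumulated factors tend to the product.
\<close>

subsection \<open>Telescoping under the shift of parameters\<close>

text \<open>
  Abel summation by parts relates the well-poised series
  \<open>\<Omega>(A; B, C, D, E) = \<Sum>\<^sub>k (1 - q\<^sup>2\<^sup>kA) (B, C, D, E; q)\<^sub>k / (qA/B, qA/C, qA/D, qA/E; q)\<^sub>k z\<^sup>k\<close> with
  \<open>z = qA\<^sup>2/BCDE\<close> to \<open>\<Omega>(qA; B, C, D, qE)\<close>. The identity below says that two such steps, in different
  directions, commute. The even steps use it with \<open>P = q\<^sup>2\<^sup>n\<close>, \<open>\<beta> = q\<^sup>nb\<close>, \<open>\<delta> = q\<^sup>nd\<close>, and the odd steps with
  \<open>P = q\<^sup>2\<^sup>n\<^sup>+\<^sup>1\<close>, \<open>\<beta> = q\<^sup>n\<^sup>+\<^sup>1d\<close>, \<open>\<delta> = q\<^sup>nb\<close>.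
\<close>

lemma cocycle_identity:
  fixes a c q P \<beta> \<delta> :: "'a :: field"
  assumes "a \<noteq> 0" "c \<noteq> 0" "\<beta> \<noteq> 0" "\<delta> \<noteq> 0"
  defines "D \<equiv> (1 - q*P*a/c) * (1 - \<beta>*\<delta>*c/a) * (1 - q*P*a/\<beta>)"
  shows "P * (1-\<beta>) * (1-\<delta>) * (1-c) * (1 - q*P*a^2/(\<beta>*\<delta>*c)) * (1 - q*P*\<delta>)
           - (1 - P*\<delta>) * (1 - P*a/\<delta>) * D
       = (P*a/\<delta>) * (1 - q*P*a/(\<beta>*c)) * (1 - c*\<delta>/a) * (1 - \<beta>*\<delta>/a) * (1 - q*P*a) * (1-\<delta>)
           - (1 - P) * (1 - P*a) * D"
proof -
  \<comment> \<open>With \<open>e\<close>, \<open>f\<close>, \<open>g\<close>, \<open>h\<close> as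
    variables every quotient becomes a monomial, so what remains is a polynomial identity modulo the
    relations \<open>ac\<close> and \<open>inv\<close>.\<close>
  define e f g h where "e = a / c" and "f = inverse \<delta>" and "g = inverse \<beta>" and "h = inverse a"
  have ac: "a = c * e" using assms by (simp add: e_def)
  have inv: "\<delta> * f = 1" "\<beta> * g = 1" "a * h = 1" 
    using assms by (simp_all add: f_def g_def h_def)
  have eqs: "q*P*a/c = q*P*e" "\<beta>*\<delta>*c/a = \<beta>*\<delta>*c*h" "q*P*a/\<beta> = q*P*a*g"
    "q*P*a^2/(\<beta>*\<delta>*c) = q*P*a*e*f*g" "P*a/\<delta> = P*a*f" "q*P*a/(\<beta>*c) = q*P*e*g" "c*\<delta>/a = c*\<delta>*h"
    "\<beta>*\<delta>/a = \<beta>*\<delta>*h"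
    by (simp_all add: e_def f_def g_def h_def field_simps power2_eq_square)
  show ?thesis unfolding D_def eqs using ac inv
    by algebra
qed

lemma qpoch_0 [simp]: "qpoch x q 0 = 1"
  by (simp add: qpoch_def)

lemma qpoch_Suc: "qpoch x q (Suc n) = qpoch x q n * (1 - q^n * x)"
  by (simp add: qpoch_def)

text \<open>Both sides are \<open>qpoch x q (Suc n)\<close>, with either the first or the last
  factor split off.\<close>

lemma qpoch_shift: "(1 - x) * qpoch (q * x) q n = qpoch x q n * (1 - q^n * x)"
  by (induction n) (simp_all add: qpoch_Suc mult_ac)

lemma qpoch_nz: "(\<And>k. 1 - q^k * x \<noteq> 0) \<Longrightarrow> qpoch x q n \<noteq> 0"
  by (simp add: qpoch_def)

text \<open>
  The condition on \<open>d\<close> comes from \<open>W_brace_den\<close>: the odd-even splitting leaves \<open>1 - q\<^sup>nd\<close> in the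
  denominator of \<open>E\<^sub>n\<close>.
\<close>

definition admissible :: "complex \<Rightarrow> complex \<Rightarrow> complex \<Rightarrow> complex \<Rightarrow> complex \<Rightarrow> bool" where
  "admissible q a b c d \<longleftrightarrow> 0 < norm q \<and> norm q < 1 \<and> a \<noteq> 0 \<and> b \<noteq> 0 \<and> c \<noteq> 0 \<and> d \<noteq> 0 \<and>
     (\<forall>x \<in> {q*a/b, q*a/c, a/d, b*c*d/a, d}. \<forall>k. 1 - q^k * x \<noteq> 0)"

text \<open>The parameter \<open>q*a/(b*c)\<close> stands where the theorem has
  \<open>q\<^sup>2*a/(b*c)\<close>: the weight absorbs the factor \<open>1 - q*a/(b*c)\<close> of
  \<open>W\<close> in exchange for \<open>1 - q^(1+n)*a/(b*c)\<close>.\<close>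

definition poch_weight :: "complex \<Rightarrow> complex \<Rightarrow> complex \<Rightarrow> complex \<Rightarrow> complex \<Rightarrow> nat \<Rightarrow> complex" where
  "poch_weight q a b c d n =
     (qpoch b q n * qpoch (q*d) q n
        * (qpoch (b*d/a) q (2*n) * qpoch (q*a/(b*c)) q n * qpoch (b*c/a) q n
           * qpoch (q*a/(c*d)) q n * qpoch (c*d/a) q n))
     / (qpoch q q (2*n) * qpoch (q*a/c) q (2*n) * qpoch (b*c*d/a) q (2*n)
        * (qpoch (q*a/b) q n * qpoch (q*a/d) q n))"

text \<open>Relative to \<open>gauss_power * poch_weight\<close>, \<open>even_term\<close> stems
  from the second summand in the braces of \<open>W\<close> and \<open>odd_term\<close> from the
  first.\<close>

definition even_term :: "complex \<Rightarrow> complex \<Rightarrow> complex \<Rightarrow> complex \<Rightarrow> complex \<Rightarrow> nat \<Rightarrow> complex" where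
  "even_term q a b c d n = ((1 - q^(3*n)*d) * (1 - q^n*a/d)) / (1 - q^n*d) / (1 - a/d)"

definition odd_term :: "complex \<Rightarrow> complex \<Rightarrow> complex \<Rightarrow> complex \<Rightarrow> complex \<Rightarrow> nat \<Rightarrow> complex" where
  "odd_term q a b c d n =
     (q^n*a/d * (1 - q^(1+n)*a/(b*c)) * (1 - q^n*c*d/a) * (1 - q^(2*n)*b*d/a) * (1 - q^(1+3*n)*b))
     / ((1 - q^(1+2*n)) * (1 - q^(1+2*n)*a/c) * (1 - q^(2*n)*b*c*d/a)) / (1 - a/d)"

text \<open>\<open>G\<^sub>n\<close> and \<open>H\<^sub>n\<close> are
  \<open>gauss_power * poch_weight\<close> times \<open>even_cert\<close> and
  \<open>odd_cert\<close>. The factor \<open>1 - q^(2*n)\<close> gives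
  \<open>G\<^sub>0 = 0\<close>.\<close>

definition even_cert :: "complex \<Rightarrow> complex \<Rightarrow> complex \<Rightarrow> complex \<Rightarrow> complex \<Rightarrow> nat \<Rightarrow> complex" where
  "even_cert q a b c d n = ((1 - q^(2*n)) * (1 - q^(2*n)*a)) / (1 - q^n*d) / (1 - a/d)"

definition odd_cert :: "complex \<Rightarrow> complex \<Rightarrow> complex \<Rightarrow> complex \<Rightarrow> complex \<Rightarrow> nat \<Rightarrow> complex" where
  "odd_cert q a b c d n =
     (q^n*a/d * (1 - q^(1+n)*a/(b*c)) * (1 - q^n*c*d/a) * (1 - q^(2*n)*b*d/a) * (1 - q^(1+2*n)*a))
     / ((1 - q^(1+2*n)*a/c) * (1 - q^(2*n)*b*c*d/a) * (1 - q^(1+n)*a/b)) / (1 - a/d)"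

definition gauss_power :: "complex \<Rightarrow> complex \<Rightarrow> complex \<Rightarrow> complex \<Rightarrow> nat \<Rightarrow> complex" where
  "gauss_power q a b d n = (q^n * a\<^sup>2 / (b*d))^n"

definition summand :: "complex \<Rightarrow> complex \<Rightarrow> complex \<Rightarrow> complex \<Rightarrow> complex \<Rightarrow> nat \<Rightarrow> complex" where
  "summand q a b c d n = gauss_power q a b d n * poch_weight q a b c d n * (even_term q a b c d n + odd_term q a b c d n)"

text \<open>This is \<rho>: it consists of the first factors of the eight infinite products, whose
  arguments the shift multiplies by \<open>q\<close>.\<close>

definition shift_factor :: "complex \<Rightarrow> complex \<Rightarrow> complex \<Rightarrow> complex \<Rightarrow> complex \<Rightarrow> complex" where
  "shift_factor q a b c d = ((1-b) * (1-q*d) * ((1-c) * (1 - q*a\<^sup>2/(b*c*d))))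
     / ((1 - q*a/b) * (1 - q*a/c) * (1 - a/d) * (1 - b*c*d/a))"

text \<open>All five arguments are multiplied by \<open>q\<close>, so the new conditions are the old
  ones with \<open>Suc k\<close> in place of \<open>k\<close>.\<close>

lemma admissible_shift:
  assumes "admissible q a b c d"
  shows "admissible q (q\<^sup>2*a) (q*b) (q*c) (q*d)"
proof -
  have q: "q \<noteq> 0" using assms by (auto simp: admissible_def)
  have nz: "1 - q^k * x \<noteq> 0" if "x \<in> {q*a/b, q*a/c, a/d, b*c*d/a, d}" for x k
    using assms that unfolding admissible_def by blast
  have "1 - q^k * (q*x) \<noteq> 0" if "x \<in> {q*a/b, q*a/c, a/d, b*c*d/a, d}" for x k
    using nz[OF that, of "Suc k"] by (simp add: mult_ac)
  moreover have "q*(q\<^sup>2*a)/(q*b) = q*(q*a/b)" "q*(q\<^sup>2*a)/(q*c) = q*(q*a/c)" "q\<^sup>2*a/(q*d) = q*(a/d)"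
    "q*b*(q*c)*(q*d)/(q\<^sup>2*a) = q*(b*c*d/a)"
    using q by (simp_all add: power2_eq_square)
  ultimately have "1 - q^k * x \<noteq> 0"
    if "x \<in> {q*(q\<^sup>2*a)/(q*b), q*(q\<^sup>2*a)/(q*c), q\<^sup>2*a/(q*d), q*b*(q*c)*(q*d)/(q\<^sup>2*a), q*d}" for x k
    using that by (metis insert_iff singletonD)
  then show ?thesis
    using assms q unfolding admissible_def by (intro conjI ballI allI) auto
qed

text \<open>The algebra behind \<open>poch_weight_shift\<close>. The equations in the hypotheses are
  instances of \<open>qpoch_shift\<close>, \<open>r\<close> and \<open>y\<close> collect the symbols
  that the shift fixes, and \<open>k\<close>, \<open>e\<close> are the factors of \<rho> that no
  symbol of the weight absorbs.\<close>

lemma quotient_shift: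
  fixes k :: "'a :: field"
  assumes "tb*B' = B*xb" "td*D' = D*xd" "tc*C' = C*xc" "th*H' = H*xh" "tf*F' = F*xf" "tg*G' = G*xg"
    and "tc \<noteq> 0" "th \<noteq> 0" "tf \<noteq> 0" "tg \<noteq> 0" 
    and "C' \<noteq> 0" "H' \<noteq> 0" "F' \<noteq> 0" "G' \<noteq> 0" "C \<noteq> 0" "H \<noteq> 0" "F \<noteq> 0" "G \<noteq> 0"
  shows "(tb*td*k) / (tf*tc*e*th) * ((B'*D'*r) / (y*C'*H'*(F'*G')))
       = (B*D*r) / (y*C*H*(F*G)) * ((xb*xd*k*tg) / (xc*xh*xf*xg*e))"
proof -
  have x: "xc = tc*C'/C" "xh = th*H'/H" "xf = tf*F'/F" "xg = tg*G'/G"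
    using assms(3-) by (simp_all add: eq_divide_eq mult.commute)
  have "(tb*td*k) / (tf*tc*e*th) * ((B'*D'*r) / (y*C'*H'*(F'*G')))
      = ((tb*B')*(td*D')*k*r) / (tf*tc*e*th*y*C'*H'*F'*G')"
    by (simp only: times_divide_times_eq mult_ac)
  also have "\<dots> = (B*D*r) / (y*C*H*(F*G)) * ((xb*xd*k*tg) / (xc*xh*xf*xg*e))"
    unfolding x assms(1,2) using assms(7-) by (simp add: mult_ac)
  finally show ?thesis .
qed

context
  fixes q a b c d :: complex
  assumes adm: "admissible q a b c d"
begin

lemma q_abcd_nz: "q \<noteq> 0" "a \<noteq> 0" "b \<noteq> 0" "c \<noteq> 0" "d \<noteq> 0"
  using adm by (auto simp: admissible_def)

lemma one_minus_nz:
  "1 - q^k * (q*a/b) \<noteq> 0" "1 - q^k * (q*a/c) \<noteq> 0" "1 - q^k * (a/d) \<noteq> 0"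
  "1 - q^k * (b*c*d/a) \<noteq> 0" "1 - q^k * d \<noteq> 0" "1 - q^k * q \<noteq> 0" "1 - q^k * (q*a/d) \<noteq> 0"
proof -
  show 3: "1 - q^k * (a/d) \<noteq> 0" for k
    using adm unfolding admissible_def by blast
  show "1 - q^k * (q*a/d) \<noteq> 0"
    using 3[of "Suc k"] by (simp add: mult_ac)
  have "norm (q ^ Suc k) < 1"
    using adm unfolding norm_power admissible_def by (intro power_less_one_iff[THEN iffD2]) auto
  then show "1 - q^k * q \<noteq> 0"
    by (metis eq_iff_diff_eq_0 less_irrefl norm_one power_Suc2)
qed (use adm in \<open>unfold admissible_def, blast\<close>)+

lemma poch_weight_shift:
  "shift_factor q a b c d * poch_weight q (q\<^sup>2*a) (q*b) (q*c) (q*d) n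
     = poch_weight q a b c d n *
       (((1 - q^n*b) * (1 - q^n*(q*d)) * ((1-c) * (1 - q*a\<^sup>2/(b*c*d))) * (1 - q*a/d))
        / ((1 - q^(2*n)*(q*a/c)) * (1 - q^(2*n)*(b*c*d/a)) * (1 - q^n*(q*a/b)) * (1 - q^n*(q*a/d)) * (1 - a/d)))"
proof -
  \<comment> \<open>The shift fixes the first five arguments and multiplies the last four by
    \<open>q\<close>.\<close>
  have eqs: "q*b*(q*d)/(q\<^sup>2*a) = b*d/a" "q*(q\<^sup>2*a)/(q*b*(q*c)) = q*a/(b*c)" "q*b*(q*c)/(q\<^sup>2*a) = b*c/a"
    "q*(q\<^sup>2*a)/(q*c*(q*d)) = q*a/(c*d)" "q*c*(q*d)/(q\<^sup>2*a) = c*d/a"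
    "q*(q\<^sup>2*a)/(q*c) = q*(q*a/c)" "q*b*(q*c)*(q*d)/(q\<^sup>2*a) = q*(b*c*d/a)"
    "q*(q\<^sup>2*a)/(q*b) = q*(q*a/b)" "q*(q\<^sup>2*a)/(q*d) = q*(q*a/d)"
    using q_abcd_nz by (simp_all add: power2_eq_square)
  have nz: "1 - q^k*(q*x) \<noteq> 0" if "\<And>k. 1 - q^k * x \<noteq> 0" for k x
    using that[of "Suc k"] by (simp add: mult_ac)
  have nz0: "1 - x \<noteq> 0" if "\<And>k. 1 - q^k * x \<noteq> 0" for x
    using that[of 0] by simp
  note n = one_minus_nz
  show ?thesis
    unfolding poch_weight_def shift_factor_def eqs
    by (rule quotient_shift; (rule qpoch_shift | rule nz0, rule n | rule qpoch_nz, rule nz, rule n | rule qpoch_nz, rule n))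
qed

lemma gauss_power_shift: "gauss_power q (q\<^sup>2*a) (q*b) (q*d) n = (q^n)\<^sup>2 * gauss_power q a b d n"
proof -
  have "q^n * (q\<^sup>2*a)\<^sup>2 / (q*b*(q*d)) = q\<^sup>2 * (q^n * a\<^sup>2/(b*d))"
    using q_abcd_nz by (simp add: power2_eq_square)
  then show ?thesis
    unfolding gauss_power_def by (simp only: power_mult_distrib power_mult[symmetric] mult.commute[of n])
qed

text \<open>After removal of \<open>gauss_power * poch_weight\<close> this is
  \<open>cocycle_identity\<close> divided by \<open>D * e * t\<close>.\<close>

lemma even_step:
  "shift_factor q a b c d * (gauss_power q (q\<^sup>2*a) (q*b) (q*d) n * poch_weight q (q\<^sup>2*a) (q*b) (q*c) (q*d) n
       * even_term q (q\<^sup>2*a) (q*b) (q*c) (q*d) n)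
     - gauss_power q a b d n * poch_weight q a b c d n * even_term q a b c d n
   = gauss_power q a b d n * poch_weight q a b c d n * (odd_cert q a b c d n - even_cert q a b c d n)"
proof -
  define X where "X = q^n"
  note nz = q_abcd_nz
  have X: "X \<noteq> 0" using nz by (simp add: X_def)
  have Xp: "q^(2*n) = X^2" "q^(3*n) = X^3" "q^(1+2*n) = q*X^2" "q^(1+n) = q*X"
    by (simp_all add: X_def power_mult[symmetric] mult.commute)
  define D where "D = (1 - X^2*(q*a/c)) * (1 - X^2*(b*c*d/a)) * (1 - X*(q*a/b))"
  define e where "e = 1 - X*d"
  define t where "t = 1 - a/d"
  have De: "D \<noteq> 0" "e \<noteq> 0" "t \<noteq> 0"
    using one_minus_nz(1,5)[of n] one_minus_nz(2,4)[of "2*n"] one_minus_nz(3)[of 0]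
    unfolding D_def e_def t_def Xp[symmetric] mult_eq_0_iff unfolding X_def by simp_all
  \<comment> \<open>The four terms of \<open>cocycle_identity\<close> are, in order,
    \<open>A1 * e\<close>, \<open>A2 * D\<close>, \<open>A3 * e\<close>, \<open>A4 * D\<close>,
    where \<open>e\<close> is its factor \<open>1 - \<delta>\<close>.\<close>
  define A1 A2 A3 A4 where
    "A1 = X^2 * (1 - X*b) * (1-c) * (1 - q*a^2/(b*c*d)) * (1 - q*X^3*d)" and
    "A2 = (1 - X^3*d) * (1 - X*a/d)" and
    "A3 = X*a/d*(1 - q*X*a/(b*c))*(1 - X*c*d/a)*(1 - X^2*b*d/a)*(1 - q*X^2*a)" and
    "A4 = (1 - X^2)*(1 - X^2*a)"
  have id: "A1 * e - A2 * D = A3 * e - A4 * D"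
  proof -
    have fr: "q*X^2*a/c = X^2*(q*a/c)" "X*b*(X*d)*c/a = X^2*(b*c*d/a)" "q*X^2*a/(X*b) = X*(q*a/b)"
      "q*X^2*a^2/(X*b*(X*d)*c) = q*a^2/(b*c*d)" "q*X^2*(X*d) = q*X^3*d" "X^2*(X*d) = X^3*d"
      "X^2*a/(X*d) = X*a/d" "q*X^2*a/(X*b*c) = q*X*a/(b*c)" "c*(X*d)/a = X*c*d/a" 
      "X*b*(X*d)/a = X^2*b*d/a"
      using X by (simp_all add: power2_eq_square power3_eq_cube)
    have "X*b \<noteq> 0" "X*d \<noteq> 0" using X nz by auto
    from cocycle_identity[OF nz(2,4) this, of "X^2" q]
    show ?thesis unfolding fr A1_def A2_def A3_def A4_def D_def e_def by (simp only: mult_ac)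
  qed
  have rw: "shift_factor q a b c d * (gauss_power q (q\<^sup>2*a) (q*b) (q*d) n * poch_weight q (q\<^sup>2*a) (q*b) (q*c) (q*d) n
       * even_term q (q\<^sup>2*a) (q*b) (q*c) (q*d) n) = gauss_power q a b d n * poch_weight q a b c d n * (A1 / D / t)"
  proof -
    \<comment> \<open>\<open>u\<close>, \<open>v\<close>, \<open>w\<close> are the factors of the
      shifted even term that cancel against \<open>poch_weight_shift\<close>.\<close>
    define u v where "u = 1 - X*(q*d)" and "v = 1 - X*(q*a/d)"
    define w where "w = 1 - q*a/d"
    have uv: "u \<noteq> 0" "v \<noteq> 0" "w \<noteq> 0"
      using one_minus_nz(5)[of "Suc n"] one_minus_nz(7)[of n] one_minus_nz(7)[of 0]
      by (simp_all add: u_def v_def w_def X_def mult_ac)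
    have ev: "even_term q (q\<^sup>2*a) (q*b) (q*c) (q*d) n = (1 - q*X^3*d) * v / u / w"
      unfolding even_term_def u_def v_def w_def Xp X_def[symmetric]
      using nz(1) by (simp add: power2_eq_square mult_ac)
    have "shift_factor q a b c d * (gauss_power q (q\<^sup>2*a) (q*b) (q*d) n * poch_weight q (q\<^sup>2*a) (q*b) (q*c) (q*d) n
       * even_term q (q\<^sup>2*a) (q*b) (q*c) (q*d) n)
       = X^2 * gauss_power q a b d n * (shift_factor q a b c d * poch_weight q (q\<^sup>2*a) (q*b) (q*c) (q*d) n)
          * ((1 - q*X^3*d) * v / u / w)"
      unfolding ev gauss_power_shift X_def by (simp only: mult_ac)
    also have "\<dots> = gauss_power q a b d n * poch_weight q a b c d n * (A1 / D / t)"
      unfolding poch_weight_shift A1_def D_def Xp X_def[symmetric] u_def[symmetric] v_def[symmetric] w_def[symmetric] t_def[symmetric]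
      using uv by (simp add: mult_ac)
    finally show ?thesis .
  qed
  have "A1 / D - A2 / e = A3 / D - A4 / e"
    using De id by (simp add: divide_simps)
  then have "A1 / D / t - A2 / e / t = A3 / D / t - A4 / e / t"
    by (metis diff_divide_distrib)
  moreover have "even_term q a b c d n = A2 / e / t" 
    unfolding even_term_def A2_def e_def t_def Xp X_def[symmetric] ..
  moreover have "odd_cert q a b c d n = A3 / D / t"
    unfolding odd_cert_def A3_def D_def t_def Xp X_def[symmetric] by (simp add: mult_ac)
  moreover have "even_cert q a b c d n = A4 / e / t"
    unfolding even_cert_def A4_def e_def t_def Xp X_def[symmetric] ..
  ultimately show ?thesis
    unfolding rw by (simp only: right_diff_distrib[symmetric])
qed

lemma poch_weight_Suc:
  "poch_weight q a b c d (Suc n) = poch_weight q a b c d n *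
     (((1 - q^n*b) * (1 - q^n*(q*d))
        * (((1 - q^(2*n)*(b*d/a)) * (1 - q^Suc (2*n)*(b*d/a))) * (1 - q^n*(q*a/(b*c))) * (1 - q^n*(b*c/a))
           * (1 - q^n*(q*a/(c*d))) * (1 - q^n*(c*d/a))))
      / (((1 - q^(2*n)*q) * (1 - q^Suc (2*n)*q)) * ((1 - q^(2*n)*(q*a/c)) * (1 - q^Suc (2*n)*(q*a/c)))
         * ((1 - q^(2*n)*(b*c*d/a)) * (1 - q^Suc (2*n)*(b*c*d/a)))
        * ((1 - q^n*(q*a/b)) * (1 - q^n*(q*a/d)))))"
proof -
  have *: "2 * Suc n = Suc (Suc (2*n))" by simp
  show ?thesis
    unfolding poch_weight_def * qpoch_Suc by (simp only: times_divide_times_eq mult_ac)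
qed

lemma gauss_power_Suc: "gauss_power q a b d (Suc n) = gauss_power q a b d n * (q^(1+2*n) * (a\<^sup>2/(b*d)))"
  by (simp add: gauss_power_def power_mult_distrib power_divide power_mult[symmetric] mult_ac mult_2_right power_add)

text \<open>Again \<open>cocycle_identity\<close>, half an index further and with \<open>b\<close>
  and \<open>d\<close> in exchanged roles. Its third term turns into
  \<open>G\<^sub>n\<^sub>+\<^sub>1\<close> through the ratios in \<open>poch_weight_Suc\<close> and
  \<open>gauss_power_Suc\<close>, which is where the index advances.\<close>

lemma odd_step:
  "shift_factor q a b c d * (gauss_power q (q\<^sup>2*a) (q*b) (q*d) n * poch_weight q (q\<^sup>2*a) (q*b) (q*c) (q*d) n
       * odd_term q (q\<^sup>2*a) (q*b) (q*c) (q*d) n)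
     - gauss_power q a b d n * poch_weight q a b c d n * odd_term q a b c d n
   = gauss_power q a b d (Suc n) * poch_weight q a b c d (Suc n) * even_cert q a b c d (Suc n)
     - gauss_power q a b d n * poch_weight q a b c d n * odd_cert q a b c d n"
proof -
  define X where "X = q^n"
  note nz = q_abcd_nz
  have X: "X \<noteq> 0" using nz by (simp add: X_def)
  have Xp: "q^(2*n) = X^2" "q^(1+2*n) = q*X^2" "q^(1+3*n) = q*X^3" "q^(1+n) = q*X"
    "q^Suc (2*n) = q*X^2" "q^Suc n = q*X"
    by (simp_all add: X_def power_mult[symmetric] mult.commute)
  have Xp2: "q^(2*Suc n) = q\<^sup>2*X^2"
    by (simp add: X_def power_even_eq power2_eq_square)
  define s where "s = 1 - X*(q*a/b)"
  define D where "D = (1 - q*X^2*(q*a/c)) * (1 - q*X^2*(b*c*d/a)) * (1 - X*(q*a/d))"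
  define e where "e = 1 - X*b"
  define f where "f = 1 - X^2*q"
  define g where "g = (1 - X^2*(q*a/c)) * (1 - X^2*(b*c*d/a))"
  define t where "t = 1 - a/d"
  have De: "D \<noteq> 0" "f \<noteq> 0" "g \<noteq> 0" "s \<noteq> 0" "t \<noteq> 0"
    using one_minus_nz(1,7)[of n] one_minus_nz(2,4)[of "Suc (2*n)"] one_minus_nz(2,4,6)[of "2*n"] one_minus_nz(3)[of 0]
    unfolding D_def f_def g_def s_def t_def Xp[symmetric] mult_eq_0_iff unfolding X_def by simp_all
  \<comment> \<open>\<open>K / (f*g)\<close> is common to the odd term, its shifted version and both
    certificates.\<close>
  define K where "K = X*a/d*(1 - q*X*a/(b*c))*(1 - X*c*d/a)*(1 - X^2*b*d/a)"
  \<comment> \<open>Here the four terms of \<open>cocycle_identity\<close> are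
    \<open>A1 * e\<close>, \<open>A2 * s * D\<close>, \<open>A3 * e\<close>, \<open>A4 * D\<close>,
    with \<open>s\<close> its factor \<open>1 - P*a/\<delta>\<close>.\<close>
  define A1 A2 A3 A4 where
    "A1 = q*X^2 * (1 - X*(q*d)) * (1-c) * (1 - q*a^2/(b*c*d)) * (1 - q^2*X^3*b)" and
    "A2 = 1 - q*X^3*b" and
    "A3 = X*(q*a/b)*(1 - X*(q*a/(c*d)))*(1 - X*(b*c/a))*(1 - q*X^2*(b*d/a))*(1 - q^2*X^2*a)" and
    "A4 = (1 - X^2*q)*(1 - q*X^2*a)"
  have id: "A1 * e - A2 * s * D = A3 * e - A4 * D"
  proof -
    have fr: "q*(q*X^2)*a/c = q*X^2*(q*a/c)" "q*X*d*(X*b)*c/a = q*X^2*(b*c*d/a)" "q*(q*X^2)*a/(q*X*d) = X*(q*a/d)"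
      "q*(q*X^2)*a^2/(q*X*d*(X*b)*c) = q*a^2/(b*c*d)" "q*(q*X^2)*(X*b) = q^2*X^3*b" "q*X^2*(X*b) = q*X^3*b"
      "q*X^2*a/(X*b) = X*(q*a/b)" "q*(q*X^2)*a/(q*X*d*c) = X*(q*a/(c*d))" "c*(X*b)/a = X*(b*c/a)" 
      "q*X*d*(X*b)/a = q*X^2*(b*d/a)" "q*(q*X^2)*a = q^2*X^2*a" "q*X*d = X*(q*d)"
      using X nz by (simp_all add: power2_eq_square power3_eq_cube) (simp add: mult_ac)
    have "q*X*d \<noteq> 0" "X*b \<noteq> 0" using X nz by auto
    from cocycle_identity[OF nz(2,4) this, of "q*X^2" q]
    show ?thesis unfolding fr(1-10) unfolding fr(11,12) A1_def A2_def A3_def A4_def D_def e_def s_def by (simp only: mult_ac)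
  qed
  let ?Y = "gauss_power q a b d n * poch_weight q a b c d n"
  have sh: "shift_factor q a b c d * (gauss_power q (q\<^sup>2*a) (q*b) (q*d) n * poch_weight q (q\<^sup>2*a) (q*b) (q*c) (q*d) n
       * odd_term q (q\<^sup>2*a) (q*b) (q*c) (q*d) n) = ?Y * (K / (f*g) * (A1 * e / D) / s / t)"
  proof -
    define w where "w = 1 - q*a/d"
    have w: "w \<noteq> 0"
      using one_minus_nz(7)[of 0] by (simp add: w_def)
    have od: "odd_term q (q\<^sup>2*a) (q*b) (q*c) (q*d) n = 
      q * K * (1 - q^2*X^3*b) / (f * (1 - q*X^2*(q*a/c)) * (1 - q*X^2*(b*c*d/a))) / w"
      unfolding odd_term_def K_def f_def w_def Xp X_def[symmetric]
      using nz(1) by (simp add: power2_eq_square mult_ac)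
    have "shift_factor q a b c d * (gauss_power q (q\<^sup>2*a) (q*b) (q*d) n * poch_weight q (q\<^sup>2*a) (q*b) (q*c) (q*d) n
       * odd_term q (q\<^sup>2*a) (q*b) (q*c) (q*d) n)
       = X^2 * gauss_power q a b d n * (shift_factor q a b c d * poch_weight q (q\<^sup>2*a) (q*b) (q*c) (q*d) n)
          * (q * K * (1 - q^2*X^3*b) / (f * (1 - q*X^2*(q*a/c)) * (1 - q*X^2*(b*c*d/a))) / w)"
      unfolding od gauss_power_shift X_def by (simp only: mult_ac)
    also have "\<dots> = ?Y * (K / (f*g) * (A1 * e / D) / s / t)"
      unfolding poch_weight_shift A1_def D_def g_def e_def Xp X_def[symmetric] s_def[symmetric] w_def[symmetric] t_def[symmetric]
      using w by (simp add: mult_ac)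
    finally show ?thesis .
  qed
  have nx: "gauss_power q a b d (Suc n) * poch_weight q a b c d (Suc n) * even_cert q a b c d (Suc n) = ?Y * (K / (f*g) * (A3 * e / D) / s / t)"
  proof -
    \<comment> \<open>\<open>u\<close> and \<open>v\<close> are the factors of
      \<open>even_cert\<close> at \<open>Suc n\<close> that cancel against the ratio of consecutive
      weights.\<close>
    define u v where "u = 1 - X*(q*d)" and "v = 1 - q*X^2*q"
    have uv: "u \<noteq> 0" "v \<noteq> 0"
      using one_minus_nz(5)[of "Suc n"] one_minus_nz(6)[of "Suc (2*n)"] 
      unfolding u_def v_def Xp by (simp_all add: mult_ac)
    have ec: "even_cert q a b c d (Suc n) = v * (1 - q^2*X^2*a) / u / t"
      unfolding even_cert_def v_def u_def t_def Xp Xp2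
      by (simp add: power2_eq_square mult_ac)
    have "gauss_power q a b d (Suc n) * poch_weight q a b c d (Suc n) * even_cert q a b c d (Suc n)
      = ?Y * (q*X^2 * (a^2/(b*d)) * (e * u * (((1 - X^2*(b*d/a)) * (1 - q*X^2*(b*d/a))) * (1 - X*(q*a/(b*c))) * (1 - X*(b*c/a))
           * (1 - X*(q*a/(c*d))) * (1 - X*(c*d/a))))
      / ((f * v) * ((1 - X^2*(q*a/c)) * (1 - q*X^2*(q*a/c)) * ((1 - X^2*(b*c*d/a)) * (1 - q*X^2*(b*c*d/a))) * (s * (1 - X*(q*a/d)))))
      * (v * (1 - q^2*X^2*a) / u / t))"
      unfolding ec poch_weight_Suc gauss_power_Suc Xp X_def[symmetric] e_def u_def v_def s_def f_def by (simp add: mult_ac)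
    also have "\<dots> = ?Y * (K / (f*g) * (A3 * e / D) / s / t)"
    proof -
      \<comment> \<open>The ratio of consecutive Gaussian powers splits into the leading monomials
        of \<open>K\<close> and \<open>A3\<close>.\<close>
      have "q*X^2 * (a^2/(b*d)) = X*a/d * (X*(q*a/b))" by (simp add: power2_eq_square mult_ac)
      then show ?thesis
        unfolding A3_def K_def D_def g_def using uv by (simp add: power2_eq_square mult_ac)
    qed
    finally show ?thesis .
  qed
  have o: "odd_term q a b c d n = K / (f*g) * A2 / t"
    unfolding odd_term_def K_def A2_def t_def f_def g_def Xp X_def[symmetric] by (simp add: mult_ac)
  have oc: "odd_cert q a b c d n = K / (f*g) * A4 / s / t"
    unfolding odd_cert_def K_def A4_def t_def g_def s_def Xp X_def[symmetric]
    using De(2) unfolding f_def by (simp add: mult_ac)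
  have "A1 * e / D - A2 * s = A3 * e / D - A4"
    using De id by (simp add: divide_simps)
  then have "K / (f*g) * (A1 * e / D - A2 * s) / s / t = K / (f*g) * (A3 * e / D - A4) / s / t"
    by simp
  then have "K / (f*g) * (A1 * e / D) / s / t - K / (f*g) * A2 / t
      = K / (f*g) * (A3 * e / D) / s / t - K / (f*g) * A4 / s / t"
    using De(4) by (simp add: right_diff_distrib diff_divide_distrib)
  then show ?thesis
    unfolding sh nx o oc by (simp only: right_diff_distrib[symmetric])
qed

end

subsection \<open>Uniform bounds along the iterated shift\<close>

text \<open>From \<open>1 + t \<le> exp t\<close> and the geometric series. The bound is free of
  \<open>n\<close> and increasing in \<open>norm x\<close>, so it serves all arguments
  \<open>q^k * x\<close> at once.\<close>

lemma norm_qpoch_le: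
  assumes "norm q < 1"
  shows "norm (qpoch x q n) \<le> exp (norm x / (1 - norm q))"
proof -
  have "norm (qpoch x q n) = (\<Prod>j<n. norm (1 - q^j * x))"
    by (simp add: qpoch_def prod_norm)
  also have "\<dots> \<le> (\<Prod>j<n. exp (norm q ^ j * norm x))"
  proof (intro prod_mono conjI norm_ge_zero)
    fix j
    have "norm (1 - q^j * x) \<le> 1 + norm q ^ j * norm x"
      by (metis norm_mult norm_one norm_power norm_triangle_ineq4)
    also have "\<dots> \<le> exp (norm q ^ j * norm x)"
      by (rule exp_ge_add_one_self)
    finally show "norm (1 - q^j * x) \<le> exp (norm q ^ j * norm x)" .
  qed
  also have "\<dots> = exp ((\<Sum>j<n. norm q ^ j) * norm x)"
    by (simp add: exp_sum[symmetric] sum_distrib_right)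
  also have "\<dots> \<le> exp (norm x / (1 - norm q))"
  proof -
    have "(\<Sum>j<n. norm q ^ j) \<le> (\<Sum>j. norm q ^ j)"
      using assms by (intro sum_le_suminf summable_geometric) auto
    also have "\<dots> = 1 / (1 - norm q)"
      using assms by (intro suminf_geometric) auto
    finally show ?thesis
      using mult_right_mono[of _ "1 / (1 - norm q)" "norm x"] by fastforce
  qed
  finally show ?thesis .
qed

lemma convergent_prod_qpoch:
  fixes q x :: complex
  assumes "norm q < 1"
  shows "convergent_prod (\<lambda>j. 1 - q^j * x)"
proof -
  have "summable (\<lambda>j. norm q ^ j * norm x)"
    using assms by (intro summable_mult2 summable_geometric) auto
  then show ?thesis
    by (intro abs_convergent_prod_imp_convergent_prod summable_imp_abs_convergent_prod)
       (simp add: norm_mult norm_power)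
qed

lemma qpoch_tendsto:
  assumes "norm q < 1"
  shows "(\<lambda>n. qpoch x q n) \<longlonglongrightarrow> qpoch_inf x q"
  using convergent_prod_LIMSEQ[OF convergent_prod_qpoch[OF assms, of x]]
  unfolding qpoch_def qpoch_inf_def
  by (subst (asm) lessThan_Suc_atMost[symmetric]) (rule LIMSEQ_imp_Suc)

text \<open>A vanishing factor makes the partial products eventually 0; conversely, a convergent
  product of nonzero factors is nonzero. This translates between the denominator of the product side
  and \<open>admissible\<close>.\<close>

lemma qpoch_inf_nz_iff:
  assumes "norm q < 1"
  shows "qpoch_inf x q \<noteq> 0 \<longleftrightarrow> (\<forall>k. 1 - q^k * x \<noteq> 0)"
proof
  assume nz: "qpoch_inf x q \<noteq> 0"
  show "\<forall>k. 1 - q^k * x \<noteq> 0"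
  proof (intro allI notI)
    fix k assume "1 - q^k * x = 0"
    then have "qpoch x q n = 0" if "n > k" for n
      unfolding qpoch_def using that by (intro prod_zero) auto
    then have "(\<lambda>n. qpoch x q n) \<longlonglongrightarrow> 0"
      by (intro tendsto_eventually eventually_sequentiallyI[of "Suc k"]) auto
    with nz qpoch_tendsto[OF assms] show False
      using LIMSEQ_unique by blast
  qed
next
  assume "\<forall>k. 1 - q^k * x \<noteq> 0"
  then show "qpoch_inf x q \<noteq> 0"
    unfolding qpoch_inf_def by (intro prodinf_nonzero convergent_prod_qpoch assms) blast
qed

text \<open>\<open>N\<close> counts the shifts and \<open>n\<close> is the summation index;
  Tannery's theorem needs bounds uniform in both.\<close>

definition unif_bounded :: "(nat \<Rightarrow> nat \<Rightarrow> complex) \<Rightarrow> bool" where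
  "unif_bounded f \<longleftrightarrow> (\<exists>K. \<forall>N n. norm (f N n) \<le> K)"

lemma unif_bounded_const: "unif_bounded (\<lambda>N n. x)"
  by (auto simp: unif_bounded_def)

lemma unif_bounded_mult:
  assumes "unif_bounded f" "unif_bounded g"
  shows "unif_bounded (\<lambda>N n. f N n * g N n)"
proof -
  obtain K L where "\<And>N n. norm (f N n) \<le> K" "\<And>N n. norm (g N n) \<le> L"
    using assms unfolding unif_bounded_def by metis
  then have "norm (f N n * g N n) \<le> K * L" for N n
    unfolding norm_mult by (meson mult_mono norm_ge_zero order_trans)
  then show ?thesis unfolding unif_bounded_def by blast
qed

lemma unif_bounded_add:
  assumes "unif_bounded f" "unif_bounded g"
  shows "unif_bounded (\<lambda>N n. f N n + g N n)"
  using assms unfolding unif_bounded_def by (meson add_mono norm_triangle_le)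

lemma unif_bounded_divide:
  assumes "unif_bounded f" "unif_bounded (\<lambda>N n. inverse (g N n))"
  shows "unif_bounded (\<lambda>N n. f N n / g N n)"
  using unif_bounded_mult[OF assms] by (simp add: divide_inverse)

lemma unif_bounded_inverse_mult:
  assumes "unif_bounded (\<lambda>N n. inverse (f N n))" "unif_bounded (\<lambda>N n. inverse (g N n))"
  shows "unif_bounded (\<lambda>N n. inverse (f N n * g N n))"
  using unif_bounded_mult[OF assms] by simp

lemma unif_bounded_qpoch:
  assumes "norm q < 1"
  shows "unif_bounded (\<lambda>N n. qpoch (q^(k N n) * x) q (m N n))"
  unfolding unif_bounded_def
proof (intro exI allI)
  fix N n
  have "norm (q^(k N n) * x) \<le> norm x"
    using assms by (simp add: norm_mult norm_power power_le_one mult_left_le_one_le)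
  then show "norm (qpoch (q^(k N n) * x) q (m N n)) \<le> exp (norm x / (1 - norm q))"
    using assms by (intro order_trans[OF norm_qpoch_le]) (auto intro!: divide_right_mono)
qed

lemma qpoch_add: "qpoch x q (k + n) = qpoch x q k * qpoch (q^k * x) q n"
  by (induction n) (simp_all add: qpoch_Suc power_add mult_ac)

text \<open>By \<open>qpoch_add\<close> the inverse is \<open>qpoch x q k\<close> divided by
  \<open>qpoch x q (k + m)\<close>. The numerator is bounded, and the inverse of the denominator is
  bounded because \<open>qpoch x q\<close> tends to a nonzero limit.\<close>

lemma unif_bounded_inverse_qpoch:
  assumes q: "norm q < 1" and nz: "\<And>k. 1 - q^k * x \<noteq> 0"
  shows "unif_bounded (\<lambda>N n. inverse (qpoch (q^(k N n) * x) q (m N n)))"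
proof -
  have "(\<lambda>n. inverse (qpoch x q n)) \<longlonglongrightarrow> inverse (qpoch_inf x q)"
    using nz qpoch_inf_nz_iff[OF q] by (intro tendsto_inverse qpoch_tendsto[OF q]) auto
  then obtain K where K: "\<And>n. norm (inverse (qpoch x q n)) \<le> K"
    by (meson BseqE convergentI convergent_imp_Bseq)
  have "inverse (qpoch (q^(k N n) * x) q (m N n))
      = qpoch (q^0 * x) q (k N n) * inverse (qpoch x q (k N n + m N n))" for N n
    using qpoch_nz[of q x, OF nz] by (simp add: qpoch_add)
  moreover have "unif_bounded (\<lambda>N n. inverse (qpoch x q (k N n + m N n)))"
    using K unfolding unif_bounded_def by blast
  ultimately show ?thesis
    using unif_bounded_mult unif_bounded_qpoch[OF q, of "\<lambda>_ _. 0"] by simp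
qed

lemma unif_bounded_power: "norm q < 1 \<Longrightarrow> unif_bounded (\<lambda>N n. q^(k N n))"
  unfolding unif_bounded_def norm_power by (meson norm_ge_zero order_less_imp_le power_le_one)

lemma unif_bounded_one_minus: "norm q < 1 \<Longrightarrow> unif_bounded (\<lambda>N n. 1 - q^(k N n) * x)"
  using unif_bounded_qpoch[of q k x "\<lambda>_ _. 1"] by (simp add: qpoch_def)

lemma unif_bounded_inverse_one_minus:
  "norm q < 1 \<Longrightarrow> (\<And>k. 1 - q^k * x \<noteq> 0) \<Longrightarrow> unif_bounded (\<lambda>N n. inverse (1 - q^(k N n) * x))"
  using unif_bounded_inverse_qpoch[of q x k "\<lambda>_ _. 1"] by (simp add: qpoch_def)

text \<open>However large \<open>M\<close> is, the base \<open>r^n * M\<close> eventually drops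
  below 1/2, and a geometric series dominates.\<close>

lemma summable_gaussian:
  fixes r M :: real
  assumes "0 \<le> r" "r < 1" "0 \<le> M"
  shows "summable (\<lambda>n. (r^n * M)^n)"
proof (rule summable_comparison_test_ev)
  have "(\<lambda>n. r^n * M) \<longlonglongrightarrow> 0 * M"
    using assms by (intro tendsto_intros LIMSEQ_power_zero) auto
  then have "\<forall>\<^sub>F n in sequentially. r^n * M < 1/2"
    by (intro order_tendstoD(2)) auto
  then show "\<forall>\<^sub>F n in sequentially. norm ((r^n * M)^n) \<le> (1/2)^n"
    by eventually_elim (use assms in \<open>auto simp: abs_mult power_mono simp flip: power_abs\<close>)
  show "summable (\<lambda>n. (1/2::real)^n)"
    by (rule summable_geometric) auto
qed

context
  fixes q a b c d :: complex
  assumes adm: "admissible q a b c d"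
begin

lemma norm_q: "norm q < 1"
  using adm by (simp add: admissible_def)

lemmas base_nz = q_abcd_nz[OF adm]
lemmas factor_nz = one_minus_nz[OF adm]

lemma gauss_power_iter:
  "gauss_power q (q^(2*N)*a) (q^N*b) (q^N*d) n = (q^n * (q^(2*N) * (a\<^sup>2/(b*d))))^n"
proof -
  have eq: "q^n*(q^(2*N)*a)\<^sup>2/(q^N*b*(q^N*d)) = q^n*(q^(2*N)*(a\<^sup>2/(b*d)))"
    using base_nz by (simp add: power2_eq_square mult_2 power_add)
  show ?thesis unfolding gauss_power_def eq ..
qed

text \<open>All arguments whose symbols must be bounded take a form that the
  \<open>unif_bounded\<close> rules match, mostly \<open>q^k * x\<close> with \<open>x\<close> free
  of \<open>N\<close>; \<open>q^0\<close> marks those that the shift fixes.\<close>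

lemma poch_weight_iter:
  "poch_weight q (q^(2*N)*a) (q^N*b) (q^N*c) (q^N*d) n =
     (qpoch (q^N*b) q n * qpoch (q^N*(q*d)) q n
        * (qpoch (q^0*(b*d/a)) q (2*n) * qpoch (q^0*(q*a/(b*c))) q n * qpoch (q^0*(b*c/a)) q n
           * qpoch (q^0*(q*a/(c*d))) q n * qpoch (q^0*(c*d/a)) q n))
     / (qpoch (q^0*q) q (2*n) * qpoch (q^N*(q*a/c)) q (2*n) * qpoch (q^N*(b*c*d/a)) q (2*n)
        * (qpoch (q^N*(q*a/b)) q n * qpoch (q^N*(q*a/d)) q n))"
proof -
  have eqs: "q*(q^N*d) = q^N*(q*d)" "q^N*b*(q^N*d)/(q^(2*N)*a) = q^0*(b*d/a)" 
    "q*(q^(2*N)*a)/(q^N*b*(q^N*c)) = q^0*(q*a/(b*c))" "q^N*b*(q^N*c)/(q^(2*N)*a) = q^0*(b*c/a)"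
    "q*(q^(2*N)*a)/(q^N*c*(q^N*d)) = q^0*(q*a/(c*d))" "q^N*c*(q^N*d)/(q^(2*N)*a) = q^0*(c*d/a)"
    "q*(q^(2*N)*a)/(q^N*c) = q^N*(q*a/c)" "q^N*b*(q^N*c)*(q^N*d)/(q^(2*N)*a) = q^N*(b*c*d/a)"
    "q*(q^(2*N)*a)/(q^N*b) = q^N*(q*a/b)" "q*(q^(2*N)*a)/(q^N*d) = q^N*(q*a/d)"
    using base_nz by (simp_all add: mult_2 power_add)
  show ?thesis unfolding poch_weight_def eqs by simp
qed

lemma even_term_iter:
  "even_term q (q^(2*N)*a) (q^N*b) (q^N*c) (q^N*d) n =
     ((1 - q^(3*n+N)*d) * (1 - q^(n+N)*(a/d))) / (1 - q^(n+N)*d) / (1 - q^N*(a/d))"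
proof -
  have eqs: "q^(3*n)*(q^N*d) = q^(3*n+N)*d" "q^n*(q^(2*N)*a)/(q^N*d) = q^(n+N)*(a/d)" "q^n*(q^N*d) = q^(n+N)*d"
    "q^(2*N)*a/(q^N*d) = q^N*(a/d)"
    using base_nz by (simp_all add: mult_2 power_add)
  show ?thesis unfolding even_term_def eqs ..
qed

text \<open>The power \<open>q^(n+N)\<close> is isolated because it sends the odd term to 0 as
  \<open>N\<close> grows.\<close>

lemma odd_term_iter:
  "odd_term q (q^(2*N)*a) (q^N*b) (q^N*c) (q^N*d) n =
     q^(n+N) * (((a/d * (1 - q^(1+n)*(a/(b*c))) * (1 - q^n*(c*d/a)) * (1 - q^(2*n)*(b*d/a)) * (1 - q^(1+3*n+N)*b))
     / ((1 - q^(2*n)*q) * (1 - q^(2*n+N)*(q*a/c)) * (1 - q^(2*n+N)*(b*c*d/a)))) / (1 - q^N*(a/d)))"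
proof -
  have eqs: "q^n*(q^(2*N)*a)/(q^N*d) = q^(n+N)*(a/d)" "q^(1+n)*(q^(2*N)*a)/(q^N*b*(q^N*c)) = q^(1+n)*(a/(b*c))"
    "q^n*(q^N*c)*(q^N*d)/(q^(2*N)*a) = q^n*(c*d/a)" "q^(2*n)*(q^N*b)*(q^N*d)/(q^(2*N)*a) = q^(2*n)*(b*d/a)"
    "q^(1+3*n)*(q^N*b) = q^(1+3*n+N)*b"
    "q^(2*n)*(q^N*b)*(q^N*c)*(q^N*d)/(q^(2*N)*a) = q^(2*n+N)*(b*c*d/a)"
    "q^(2*N)*a/(q^N*d) = q^N*(a/d)"
    "q^(1+2*n)*(q^(2*N)*a)/(q^N*c) = q^(2*n+N)*(q*a/c)"
    using base_nz by (simp_all add: mult_2 power_add)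
  have q: "q^(1+2*n) = q^(2*n)*q" by simp
  show ?thesis unfolding odd_term_def eqs unfolding q by (simp add: mult.assoc)
qed

lemmas unif_bounded_intros = unif_bounded_mult unif_bounded_add unif_bounded_divide unif_bounded_inverse_mult
  unif_bounded_const unif_bounded_qpoch[OF norm_q] unif_bounded_power[OF norm_q] unif_bounded_one_minus[OF norm_q]

lemma poch_weight_bounded: "unif_bounded (\<lambda>N n. poch_weight q (q^(2*N)*a) (q^N*b) (q^N*c) (q^N*d) n)"
  unfolding poch_weight_iter
  by (intro unif_bounded_intros unif_bounded_inverse_qpoch norm_q factor_nz)

lemma terms_bounded: 
  "unif_bounded (\<lambda>N n. even_term q (q^(2*N)*a) (q^N*b) (q^N*c) (q^N*d) n
                      + odd_term q (q^(2*N)*a) (q^N*b) (q^N*c) (q^N*d) n)"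
  unfolding even_term_iter odd_term_iter
  by (intro unif_bounded_intros unif_bounded_inverse_one_minus norm_q factor_nz)

lemma even_cert_bounded: "unif_bounded (\<lambda>N n. even_cert q a b c d n)"
proof -
  have *: "1 - a/d = 1 - q^0 * (a/d)" by simp
  show ?thesis
    unfolding even_cert_def *
    using unif_bounded_one_minus[OF norm_q, of "\<lambda>_ n. 2*n" 1]
    by (intro unif_bounded_intros unif_bounded_inverse_one_minus norm_q factor_nz) simp_all
qed

text \<open>One Gaussian majorant serves three ends: summability at \<open>N = 0\<close>, decay in
  \<open>N\<close> of the terms with \<open>n > 0\<close>, and domination in Tannery's
  theorem.\<close>

lemma summand_bound:
  obtains K where "\<And>N n. norm (summand q (q^(2*N)*a) (q^N*b) (q^N*c) (q^N*d) n)
    \<le> K * (norm q ^ n * (norm q ^ (2*N) * norm (a\<^sup>2/(b*d))))^n"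
proof -
  obtain K where K: "\<And>N n. norm (poch_weight q (q^(2*N)*a) (q^N*b) (q^N*c) (q^N*d) n *
    (even_term q (q^(2*N)*a) (q^N*b) (q^N*c) (q^N*d) n
                      + odd_term q (q^(2*N)*a) (q^N*b) (q^N*c) (q^N*d) n)) \<le> K"
    using unif_bounded_mult[OF poch_weight_bounded terms_bounded] unfolding unif_bounded_def by blast
  show ?thesis
  proof (rule that[of K])
    fix N n
    show "norm (summand q (q^(2*N)*a) (q^N*b) (q^N*c) (q^N*d) n)
      \<le> K * (norm q ^ n * (norm q ^ (2*N) * norm (a\<^sup>2/(b*d))))^n"
      using mult_right_mono[OF K[of N n], of "(norm q ^ n * (norm q ^ (2*N) * norm (a\<^sup>2/(b*d))))^n"]
      unfolding summand_def gauss_power_iter mult.assoc norm_mult norm_power by (simp add: mult_ac)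
  qed
qed

lemma summable_summand: "summable (summand q a b c d)"
proof -
  obtain K where K: "\<And>N n. norm (summand q (q^(2*N)*a) (q^N*b) (q^N*c) (q^N*d) n)
    \<le> K * (norm q ^ n * (norm q ^ (2*N) * norm (a\<^sup>2/(b*d))))^n"
    using summand_bound by blast
  show ?thesis
  proof (rule summable_comparison_test')
    show "summable (\<lambda>n. K * (norm q ^ n * norm (a\<^sup>2/(b*d)))^n)"
      using norm_q by (intro summable_mult summable_gaussian) auto
    show "norm (summand q a b c d n) \<le> K * (norm q ^ n * norm (a\<^sup>2/(b*d)))^n" for n
      using K[of 0 n] by simp
  qed
qed

text \<open>The boundary term \<open>G\<^sub>n\<close> of the telescoping sum is a bounded factor
  times a Gaussian power.\<close>

lemma cert_tendsto: "(\<lambda>n. gauss_power q a b d n * poch_weight q a b c d n * even_cert q a b c d n) \<longlonglongrightarrow> 0"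
proof -
  have "unif_bounded (\<lambda>N n. poch_weight q (q^(2*0)*a) (q^0*b) (q^0*c) (q^0*d) n)"
    using poch_weight_bounded unfolding unif_bounded_def by blast
  from unif_bounded_mult[OF this even_cert_bounded]
  obtain K where K: "\<And>n. norm (poch_weight q a b c d n * even_cert q a b c d n) \<le> K"
    unfolding unif_bounded_def by auto
  have "summable (\<lambda>n. (norm q ^ n * norm (a\<^sup>2/(b*d)))^n)"
    using norm_q by (intro summable_gaussian) auto
  then have "(\<lambda>n. norm (gauss_power q a b d n)) \<longlonglongrightarrow> 0"
    unfolding gauss_power_def by (subst norm_power) (simp add: norm_mult norm_divide norm_power summable_LIMSEQ_zero)
  then have "(\<lambda>n. norm (gauss_power q a b d n) * K) \<longlonglongrightarrow> 0"
    by (rule tendsto_mult_left_zero)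
  then show ?thesis
    by (rule Lim_null_comparison[rotated])
       (use K in \<open>auto simp: mult.assoc norm_mult[of "gauss_power _ _ _ _ _"] intro!: always_eventually mult_left_mono\<close>)
qed

end

text \<open>Adding \<open>even_step\<close> and \<open>odd_step\<close> cancels
  \<open>H\<^sub>n\<close> and leaves \<open>G\<^sub>n\<^sub>+\<^sub>1 - G\<^sub>n\<close>, whose
  sum is 0.\<close>

lemma suminf_shift:
  assumes adm: "admissible q a b c d"
  shows  "suminf (summand q a b c d) = shift_factor q a b c d * suminf (summand q (q\<^sup>2*a) (q*b) (q*c) (q*d))"
proof -
  define G where "G n = gauss_power q a b d n * poch_weight q a b c d n * even_cert q a b c d n" for n
  have "shift_factor q a b c d * summand q (q\<^sup>2*a) (q*b) (q*c) (q*d) n - summand q a b c d n = G (Suc n) - G n" for n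
  proof -
    have comb: "(r * e' + r * o') - (e + o1) = g - y * ec"
      if "r * e' - e = y * (oc - ec)" "r * o' - o1 = g - y * oc" for r e e' o1 o' g y ec oc :: complex
      using that by algebra
    show ?thesis
      unfolding summand_def G_def distrib_left by (rule comb[OF even_step[OF adm] odd_step[OF adm]])
  qed
  moreover have "(\<lambda>n. G (Suc n) - G n) sums (0 - G 0)"
    using cert_tendsto[OF adm] by (intro telescope_sums) (simp add: G_def)
  moreover have "G 0 = 0" by (simp add: G_def even_cert_def)
  ultimately have "(\<lambda>n. shift_factor q a b c d * summand q (q\<^sup>2*a) (q*b) (q*c) (q*d) n - summand q a b c d n) sums 0"
    by simp
  moreover have "summable (summand q (q\<^sup>2*a) (q*b) (q*c) (q*d))"
    by (intro summable_summand admissible_shift adm)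
  ultimately show ?thesis
    using summable_summand[OF adm] by (simp add: sums_iff suminf_diff[symmetric] suminf_mult[symmetric] summable_mult)
qed

subsection \<open>Iterating the shift\<close>

lemma admissible_iter:
  assumes "admissible q a b c d"
  shows "admissible q (q^(2*N)*a) (q^N*b) (q^N*c) (q^N*d)"
proof (induction N)
  case (Suc N)
  then show ?case using admissible_shift[OF Suc] by (simp add: power2_eq_square mult.assoc)
qed (use assms in simp)

lemma shift_factor_iter:
  assumes "admissible q a b c d"
  shows "shift_factor q (q^(2*N)*a) (q^N*b) (q^N*c) (q^N*d)
    = ((1 - q^N*b) * (1 - q^N*(q*d)) * ((1 - q^N*c) * (1 - q^N*(q*a\<^sup>2/(b*c*d)))))
      / ((1 - q^N*(q*a/b)) * (1 - q^N*(q*a/c)) * (1 - q^N*(a/d)) * (1 - q^N*(b*c*d/a)))"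
proof -
  have eqs: "q*(q^N*d) = q^N*(q*d)" "q*(q^(2*N)*a)\<^sup>2/(q^N*b*(q^N*c)*(q^N*d)) = q^N*(q*a\<^sup>2/(b*c*d))"
    "q*(q^(2*N)*a)/(q^N*b) = q^N*(q*a/b)" "q*(q^(2*N)*a)/(q^N*c) = q^N*(q*a/c)" 
    "q^(2*N)*a/(q^N*d) = q^N*(a/d)" "q^N*b*(q^N*c)*(q^N*d)/(q^(2*N)*a) = q^N*(b*c*d/a)"
    using q_abcd_nz[OF assms] by (simp_all add: mult_2 power_add power2_eq_square) (simp add: mult_ac)
  show ?thesis unfolding shift_factor_def eqs ..
qed

text \<open>The shift factor at the \<open>N\<close>-th iterate supplies the factors by which
  \<open>qpoch_Suc\<close> extends the eight symbols.\<close>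

lemma suminf_iter:
  assumes adm: "admissible q a b c d"
  shows "suminf (summand q a b c d)
    = (qpoch b q N * qpoch (q*d) q N * (qpoch c q N * qpoch (q*a\<^sup>2/(b*c*d)) q N))
      / (qpoch (q*a/b) q N * qpoch (q*a/c) q N * qpoch (a/d) q N * qpoch (b*c*d/a) q N)
      * suminf (summand q (q^(2*N)*a) (q^N*b) (q^N*c) (q^N*d))"
proof (induction N)
  case (Suc N)
  have eqs: "q\<^sup>2*(q^(2*N)*a) = q^(2*Suc N)*a" "q*(q^N*x) = q^Suc N*x" for x
    by (simp_all add: power2_eq_square)
  show ?case
    unfolding qpoch_Suc using Suc suminf_shift[OF admissible_iter[OF adm, of N]]
    unfolding shift_factor_iter[OF adm] eqs by (simp only: times_divide_times_eq mult_ac times_divide_eq_right times_divide_eq_left divide_divide_eq_left)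
qed simp

lemma suminf_iter_tendsto:
  assumes adm: "admissible q a b c d"
  shows "(\<lambda>N. suminf (summand q (q^(2*N)*a) (q^N*b) (q^N*c) (q^N*d))) \<longlonglongrightarrow> 1"
proof -
  have q: "norm q < 1" using adm by (simp add: admissible_def)
  have q0: "(\<lambda>N. q^N) \<longlonglongrightarrow> 0" using q by (rule LIMSEQ_power_zero)
  obtain K where K: "\<And>N n. norm (summand q (q^(2*N)*a) (q^N*b) (q^N*c) (q^N*d) n)
    \<le> K * (norm q ^ n * (norm q ^ (2*N) * norm (a\<^sup>2/(b*d))))^n"
    using summand_bound[OF adm] by blast
  have K0: "K \<ge> 0"
    using order_trans[OF norm_ge_zero K[of 0 0]] by simp
  let ?t = "\<lambda>n N. summand q (q^(2*N)*a) (q^N*b) (q^N*c) (q^N*d) n"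
  have lim: "(?t n) \<longlonglongrightarrow> (if n = 0 then 1 else 0)" for n
  proof (cases "n = 0")
    case True
    \<comment> \<open>At index 0 the Gaussian power and the weight are 1, and so is the even term,
      since its numerator and denominators cancel.\<close>
    have t0: "?t 0 N = 1 + odd_term q (q^(2*N)*a) (q^N*b) (q^N*c) (q^N*d) 0" for N
      using one_minus_nz(3,5)[OF adm, of N]
      by (simp add: summand_def gauss_power_def poch_weight_iter[OF adm] even_term_iter[OF adm])
    have "q \<noteq> 1" using q by auto
    then have "(\<lambda>N. odd_term q (q^(2*N)*a) (q^N*b) (q^N*c) (q^N*d) 0) \<longlonglongrightarrow> 0"
      unfolding odd_term_iter[OF adm] using q q_abcd_nz[OF adm]
      by (auto simp: power_add intro!: tendsto_eq_intros q0)
    then show ?thesis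
      using True by (auto simp: t0 intro!: tendsto_eq_intros)
  next
    case False
    \<comment> \<open>For \<open>n > 0\<close> the majorant itself tends to 0, as its base contains
      \<open>norm q ^ (2*N)\<close>.\<close>
    have "(\<lambda>N. (norm q ^ 2)^N) \<longlonglongrightarrow> 0"
      using q by (intro LIMSEQ_power_zero) (simp add: power_less_one_iff)
    then have "(\<lambda>N. norm q ^ (2*N)) \<longlonglongrightarrow> 0"
      by (simp add: power_mult)
    then have "(\<lambda>N. K * (norm q ^ n * (norm q ^ (2*N) * norm (a\<^sup>2/(b*d))))^n) \<longlonglongrightarrow>
        K * (norm q ^ n * (0 * norm (a\<^sup>2/(b*d))))^n"
      by (intro tendsto_intros)
    then have "(\<lambda>N. K * (norm q ^ n * (norm q ^ (2*N) * norm (a\<^sup>2/(b*d))))^n) \<longlonglongrightarrow> 0"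
      using False by (simp add: zero_power)
    then have "(?t n) \<longlonglongrightarrow> 0"
      by (rule Lim_null_comparison[rotated]) (use K in auto)
    with False show ?thesis by simp
  qed
  \<comment> \<open>The majorant at \<open>N = 0\<close> dominates those at all \<open>N\<close>,
    because \<open>norm q ^ (2*N)\<close> is at most 1.\<close>
  have "norm (?t n N) \<le> K * (norm q ^ n * norm (a\<^sup>2/(b*d)))^n" for n N
    using q K0 by (intro order_trans[OF K] mult_left_mono power_mono mult_left_le_one_le power_le_one) auto
  then have "\<forall>\<^sub>F (n, N) in at_top \<times>\<^sub>F sequentially. norm (?t n N) \<le> K * (norm q ^ n * norm (a\<^sup>2/(b*d)))^n"
    by (intro always_eventually) auto
  moreover have "summable (\<lambda>n. K * (norm q ^ n * norm (a\<^sup>2/(b*d)))^n)"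
    using q by (intro summable_mult summable_gaussian) auto
  ultimately have "(\<lambda>N. suminf (\<lambda>n. ?t n N)) \<longlonglongrightarrow> (\<Sum>n. if n = 0 then 1 else 0)"
    using tannerys_theorem[of ?t, OF lim] by simp
  moreover have "(\<Sum>n. if n = 0 then 1 else 0) = (1::complex)"
    using sums_single[of 0 "\<lambda>_. 1::complex"] by (simp add: sums_iff)
  ultimately show ?thesis by simp
qed

lemma summand_sums:
  assumes adm: "admissible q a b c d"
  shows "summand q a b c d sums
    ((qpoch_inf b q * qpoch_inf (q*d) q * (qpoch_inf c q * qpoch_inf (q*a\<^sup>2/(b*c*d)) q))
      / (qpoch_inf (q*a/b) q * qpoch_inf (q*a/c) q * qpoch_inf (a/d) q * qpoch_inf (b*c*d/a) q))"
    (is "_ sums ?P")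
proof -
  have q: "norm q < 1" using adm by (simp add: admissible_def)
  have nz: "qpoch_inf (q*a/b) q \<noteq> 0" "qpoch_inf (q*a/c) q \<noteq> 0" "qpoch_inf (a/d) q \<noteq> 0" "qpoch_inf (b*c*d/a) q \<noteq> 0"
    unfolding qpoch_inf_nz_iff[OF q] using one_minus_nz[OF adm] by blast+
  have "(\<lambda>N. (qpoch b q N * qpoch (q*d) q N * (qpoch c q N * qpoch (q*a\<^sup>2/(b*c*d)) q N))
      / (qpoch (q*a/b) q N * qpoch (q*a/c) q N * qpoch (a/d) q N * qpoch (b*c*d/a) q N)
      * suminf (summand q (q^(2*N)*a) (q^N*b) (q^N*c) (q^N*d))) \<longlonglongrightarrow> ?P * 1"
    by (intro tendsto_intros qpoch_tendsto[OF q] suminf_iter_tendsto[OF adm] no_zero_divisors nz)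
  \<comment> \<open>By \<open>suminf_iter\<close> the sequence is constant in \<open>N\<close>, so
    its value is the limit.\<close>
  then have "(\<lambda>N. suminf (summand q a b c d)) \<longlonglongrightarrow> ?P * 1"
    unfolding suminf_iter[OF adm, symmetric] .
  then have "suminf (summand q a b c d) = ?P"
    by (simp add: LIMSEQ_const_iff)
  with summable_summand[OF adm] show ?thesis by (simp add: sums_iff)
qed

section \<open>Identification of the stated series with the even and odd terms\<close>

text \<open>This splits the braces of \<open>W\<close>: \<open>e1\<close> to \<open>e5\<close> are
  the factors of \<open>W_brace_den\<close>, \<open>t\<close> and \<open>f1\<close> to
  \<open>f3\<close> those of \<open>W_prefactor_den\<close>, and the equation for \<open>Q\<close>
  and \<open>Q'\<close> is \<open>qpoch_shift\<close> at \<open>q*a/(b*c)\<close>.\<close>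

lemma combine_terms:
  fixes s :: "'a :: field"
  assumes "s * Q' = Q * e1"
    and "e1 \<noteq> 0" "e2 \<noteq> 0" "e3 \<noteq> 0" "e4 \<noteq> 0" "e5 \<noteq> 0" "f1 \<noteq> 0" "f2 \<noteq> 0" "f3 \<noteq> 0" "t \<noteq> 0"
  shows "s*e3*e4*e5 / (t*f1*f2*f3) * (x + (g*f1*f2*f3*h) / (e1*e2*e3*e4*e5)) * Q'
    = Q * (h*g/e2/t + (x*e1*e3*e4*e5) / (f1*f2*f3) / t)"
proof -
  have "s*e3*e4*e5 / (t*f1*f2*f3) * (x + (g*f1*f2*f3*h) / (e1*e2*e3*e4*e5)) * Q'
    = (s*Q')*e3*e4*e5 / (t*f1*f2*f3) * (x + (g*f1*f2*f3*h) / (e1*e2*e3*e4*e5))"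
    by (simp add: mult_ac)
  also have "\<dots> = Q * (h*g/e2/t + (x*e1*e3*e4*e5) / (f1*f2*f3) / t)"
    unfolding assms(1) using assms(2-) by (simp add: field_simps)
  finally show ?thesis .
qed

lemma W_term_eq_summand:
  assumes "W_prefactor_den q n a b c d \<noteq> 0" and "W_brace_den q n a b c d \<noteq> 0"
  shows "W q n a b c d * (q ^ n * a\<^sup>2 / (b * d)) ^ n
            * (qpoch (b * d / a) q (2 * n)
               * qpochs [b, q * d, q\<^sup>2 * a / (b * c), b * c / a, q * a / (c * d), c * d / a] q n)
            / (qpochs [q, q * a / c, b * c * d / a] q (2 * n)
               * qpochs [q * a / b, q * a / d] q n) = summand q a b c d n"
proof -
  have "(1 - q*a/(b*c)) * qpoch (q\<^sup>2*a/(b*c)) q n = qpoch (q*a/(b*c)) q n * (1 - q^(1+n)*a/(b*c))"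
    using qpoch_shift[of "q*a/(b*c)" q n] by (simp add: power2_eq_square mult_ac)
  from combine_terms[OF this, of "1 - q^n*d" "1 - q^n*c*d/a" "1 - q^(2*n)*b*d/a" "1 - q^(1+3*n)*b"
      "1 - q^(1+2*n)" "1 - q^(1+2*n)*a/c" "1 - q^(2*n)*b*c*d/a" "1 - a/d" "q^n*(a/d)" "1 - q^n*a/d" "1 - q^(3*n)*d"]
  have "W q n a b c d * qpoch (q\<^sup>2*a/(b*c)) q n 
     = qpoch (q*a/(b*c)) q n * (even_term q a b c d n + odd_term q a b c d n)"
    using assms unfolding W_def W_prefactor_den_def W_brace_den_def even_term_def odd_term_def
    by (simp only: mult_eq_0_iff de_Morgan_disj times_divide_eq_right not_False_eq_True)
  \<comment> \<open>All other factors of the summand enter as the single multiplier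
    \<open>y\<close>.\<close>
  then have "(W q n a b c d * qpoch (q\<^sup>2*a/(b*c)) q n) * y
     = (qpoch (q*a/(b*c)) q n * (even_term q a b c d n + odd_term q a b c d n)) * y" for y
    by simp
  from this[of "gauss_power q a b d n * (qpoch b q n * qpoch (q*d) q n
        * (qpoch (b*d/a) q (2*n) * qpoch (b*c/a) q n
           * qpoch (q*a/(c*d)) q n * qpoch (c*d/a) q n))
     / (qpoch q q (2*n) * qpoch (q*a/c) q (2*n) * qpoch (b*c*d/a) q (2*n)
        * (qpoch (q*a/b) q n * qpoch (q*a/d) q n))"]
  show ?thesis
    unfolding summand_def poch_weight_def gauss_power_def qpochs_def
    by (simp only: list.map prod_list.Cons prod_list.Nil mult_1_right mult_1_left times_divide_eq_right times_divide_eq_left mult_ac)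
qed

theorem theorem5:
  fixes q a b c d :: complex
  assumes "0 < norm q" and "norm q < 1"
    and "a \<noteq> 0" and "b \<noteq> 0" and "c \<noteq> 0" and "d \<noteq> 0"
    and "qpoch_inf (q * a / b) q * qpoch_inf (q * a / c) q
           * qpoch_inf (a / d) q * qpoch_inf (b * c * d / a) q \<noteq> 0"
    and "\<And>n. qpochs [q, q * a / c, b * c * d / a] q (2 * n)
                * qpochs [q * a / b, q * a / d] q n \<noteq> 0"
    and "\<And>n. W_prefactor_den q n a b c d \<noteq> 0"
    and "\<And>n. W_brace_den q n a b c d \<noteq> 0"
  shows "(\<lambda>n. W q n a b c d * (q ^ n * a\<^sup>2 / (b * d)) ^ n
            * (qpoch (b * d / a) q (2 * n)
               * qpochs [b, q * d, q\<^sup>2 * a / (b * c), b * c / a, q * a / (c * d), c * d / a] q n)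
            / (qpochs [q, q * a / c, b * c * d / a] q (2 * n)
               * qpochs [q * a / b, q * a / d] q n))
         sums
           ((qpoch_inf b q * qpoch_inf c q * qpoch_inf (q * d) q
               * qpoch_inf (q * a\<^sup>2 / (b * c * d)) q)
            / (qpoch_inf (q * a / b) q * qpoch_inf (q * a / c) q
               * qpoch_inf (a / d) q * qpoch_inf (b * c * d / a) q))"
proof -
  have "\<forall>k. 1 - q^k * x \<noteq> 0" if "x \<in> {q*a/b, q*a/c, a/d, b*c*d/a}" for x
    using that assms(7) qpoch_inf_nz_iff[OF assms(2), of x] by auto
  moreover have "\<forall>k. 1 - q^k * d \<noteq> 0"
    using assms(10) unfolding W_brace_den_def by auto
  ultimately have "admissible q a b c d"
    unfolding admissible_def using assms(1-6) by blast
  from summand_sums[OF this] show ?thesis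
    unfolding W_term_eq_summand[OF assms(9,10)] by (simp only: mult_ac)
qed

end
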